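(* Suppose that $\ell(Z,w)$, $Z\sim p$, is $\sigma^2$-subgaussian for every $w\in\mathscr{W}$. Then for any learning algorithm, i.e. any random mapping $Z^n\to W$ with $Z^n=(Z_1,\ldots,Z_n)$ i.i.d. from $p$ and $W$ taking values in $\mathscr{W}$, $$\big|\mathsf{E}\big(L(W)-L_n(W)\big)\big|\le\sqrt{\frac{2\sigma^2}{n}I(W;Z^n)} .$$
   Context: Learning setup: $\mathscr{Z}$ is a data space, $\mathscr{W}$ a model class, $\ell:\mathscr{Z}\times\mathscr{W}\to[0,\infty)$ a (measurable) loss function, $p$ a probability distribution on $\mathscr{Z}$. A learning algorithm is a conditional distribution (channel) of $W\in\mathscr{W}$ given $Z^n$. $L(w)=\mathsf{E}(\ell(Z,w))$ with $Z\sim p$, and $L(W)$ is $L$ evaluated at $W$ (so the fresh sample $Z$ is independent of $(Z^n,W)$); $L_n(W)=\frac1n\sum_{i=1}^n\ell(Z_i,W)$. The expectation is over the joint distribution of $(Z^n,W)$. $I(W;Z^n)$ is mutual information in nats (natural logarithm). A random variable $X$ is $\sigma^2$-subgaussian if $\mathsf{E}(e^{\lambda(X-\mathsf{E}X)})\le e^{\lambda^2\sigma^2/2}$ for all $\lambda\in\mathbb{R}$.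
   Formalization: The degenerate case σ = 0 with I(W;Zⁿ) = ∞ is excluded, since the right side is then the indeterminate form 0·∞ (and the bound fails if this is read as 0, e.g. Z uniform on [0,1], W = Z₁, ℓ(z,w) = 1[z = w]). *)

theory Defs
  imports "HOL-Probability.Probability"
begin

text \<open>
  In the library, \<open>KL_divergence\<close> and \<open>mutual_information\<close> are real-valued, with a meaningless
  value whenever the relative entropy is infinite. The variant below takes values in \<open>[0, \<infinity>]\<close>.
  It is \<open>\<infinity>\<close> when the joint distribution is not absolutely continuous with respect to
  the product of the marginals, or when it is but the log density is not integrable; the negative
  part of the log density is always integrable for probability measures, so in the latter case
  the divergence is indeed \<open>\<infinity>\<close> rather than undefined.
\<close>

definition (in prob_space) ext_mutual_information ::
    "real \<Rightarrow> 'b measure \<Rightarrow> 'c measure \<Rightarrow> ('a \<Rightarrow> 'b) \<Rightarrow> ('a \<Rightarrow> 'c) \<Rightarrow> ereal" where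
  "ext_mutual_information b S T X Y =
     (let P = distr M S X \<Otimes>\<^sub>M distr M T Y;
          Q = distr M (S \<Otimes>\<^sub>M T) (\<lambda>x. (X x, Y x))
      in if absolutely_continuous P Q \<and> integrable Q (entropy_density b P Q)
         then ereal (mutual_information b S T X Y) else \<infinity>)"

text \<open>
  The Bochner integral of a non-integrable function is \<open>0\<close>, so the existence of the mean and of
  the moment generating function is part of the definition. The parameter \<open>v\<close> is the
  variance proxy, written \<open>\<sigma>\<^sup>2\<close> in the literature.
\<close>

definition (in prob_space) subgaussian :: "real \<Rightarrow> ('a \<Rightarrow> real) \<Rightarrow> bool" where
  "subgaussian v X \<longleftrightarrow>
     integrable M X \<and>
     (\<forall>t. integrable M (\<lambda>x. exp (t * (X x - expectation X))) \<and>
          expectation (\<lambda>x. exp (t * (X x - expectation X))) \<le> exp (t\<^sup>2 * v / 2))"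

definition iid_sample :: "'z measure \<Rightarrow> nat \<Rightarrow> (nat \<Rightarrow> 'z) measure" where
  "iid_sample p n = PiM {1..n} (\<lambda>_. p)"

text \<open>
  A channel from \<open>M\<close> to \<open>N\<close> is a Markov kernel, an element of \<open>M \<rightarrow>\<^sub>M prob_algebra N\<close>;
  \<open>channel_joint M N K\<close> is the law of \<open>(x, y)\<close> where \<open>x\<close> is drawn from \<open>M\<close> and then \<open>y\<close> from \<open>K x\<close>.
\<close>

definition channel_joint :: "'a measure \<Rightarrow> 'b measure \<Rightarrow> ('a \<Rightarrow> 'b measure) \<Rightarrow> ('a \<times> 'b) measure" where
  "channel_joint M N K = M \<bind> (\<lambda>x. K x \<bind> (\<lambda>y. return (M \<Otimes>\<^sub>M N) (x, y)))"

definition population_risk :: "'z measure \<Rightarrow> ('z \<Rightarrow> 'w \<Rightarrow> real) \<Rightarrow> 'w \<Rightarrow> real" where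
  "population_risk p loss w = (\<integral>z. loss z w \<partial>p)"

definition empirical_risk :: "('z \<Rightarrow> 'w \<Rightarrow> real) \<Rightarrow> nat \<Rightarrow> (nat \<Rightarrow> 'z) \<Rightarrow> 'w \<Rightarrow> real" where
  "empirical_risk loss n z w = (\<Sum>i=1..n. loss (z i) w) / real n"

text \<open>\<open>I(W; Z\<^sup>n)\<close> in nats: the logarithm has base \<open>exp 1\<close>.\<close>

definition learning_information ::
    "'z measure \<Rightarrow> nat \<Rightarrow> 'w measure \<Rightarrow> ((nat \<Rightarrow> 'z) \<Rightarrow> 'w measure) \<Rightarrow> ereal" where
  "learning_information p n MW K =
     prob_space.ext_mutual_information (channel_joint (iid_sample p n) MW K)
       (exp 1) MW (iid_sample p n) snd fst"

text \<open>Only used on \<open>[0, \<infinity>]\<close>.\<close>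

definition ereal_sqrt :: "ereal \<Rightarrow> ereal" where
  "ereal_sqrt x = (if x = \<infinity> then \<infinity> else ereal (sqrt (real_of_ereal x)))"

end

(*
  Let P be the product of the marginals of (W, Z^n), Q their joint law, D = dQ/dP and
  g = L(W) - L_n(W). Under P the sample is independent of W, so conditioning on W and using the
  product form of the law of Z^n gives E_P exp(t g) <= exp(t^2 sigma^2 / (2n)) for every t.
  Young's inequality D a <= D ln D - D + exp a, with a = g, -g, shows that g is Q-integrable;
  with a = t g - t^2 sigma^2 / (2n) and integrated over P it gives
  t E_Q g <= I(W; Z^n) + t^2 sigma^2 / (2n). Optimising over t yields the bound.
*)

theory Submission
  imports Defs
begin

text \<open>This is the Fenchel-Young inequality for the convex conjugate pair x ln x - x and exp.
  For x > 0, dividing by x turns it into 1 + u <= exp u at u = a - ln x.\<close>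

lemma young_ineq_exp:
  fixes x a :: real
  assumes "0 \<le> x"
  shows "x * a \<le> x * ln x - x + exp a"
proof (cases "x = 0")
  case False
  then have x: "0 < x"
    using assms by simp
  have "1 + (a - ln x) \<le> exp (a - ln x)"
    by (rule exp_ge_add_one_self)
  then have "x * (1 + (a - ln x)) \<le> x * exp (a - ln x)"
    using x by (intro mult_left_mono) auto
  also have "\<dots> = exp a"
    using x by (simp add: exp_diff)
  finally show ?thesis
    by (simp add: algebra_simps)
qed simp

context
  fixes P Q :: "'a measure"
  assumes P: "prob_space P" and Q: "prob_space Q"
    and ac: "absolutely_continuous P Q" and sets_eq: "sets Q = sets P"
    and entropy_integrable: "integrable Q (entropy_density (exp 1) P Q)"
begin

interpretation P: prob_space P by (rule P)
interpretation Q: prob_space Q by (rule Q)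

private abbreviation (input) "D \<equiv> \<lambda>x. enn2real (RN_deriv P Q x)"

private lemmas RN =
  P.RN_deriv_integrable[OF Q.sigma_finite_measure_axioms ac sets_eq]
  P.RN_deriv_integral[OF Q.sigma_finite_measure_axioms ac sets_eq]

text \<open>Change of measure turns the \<open>Q\<close>-integral of f into the
  \<open>P\<close>-integral of \<open>D\<close> * f; here f is the constant 1 and the log density.
  The latter writes the divergence as an integral over \<open>P\<close>, where Young's inequality
  can be integrated.\<close>

private lemma density_integrals:
  shows "integrable P D" "(\<integral>x. D x \<partial>P) = 1"
    "integrable P (\<lambda>x. D x * ln (D x))"
    "(\<integral>x. D x * ln (D x) \<partial>P) = KL_divergence (exp 1) P Q"
proof -
  have ed: "entropy_density (exp 1) P Q = (\<lambda>x. ln (D x))"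
    by (auto simp: entropy_density_def log_def)
  show "integrable P D" "(\<integral>x. D x \<partial>P) = 1"
    using RN[of "\<lambda>_. 1"] by (simp_all add: Q.prob_space)
  show "integrable P (\<lambda>x. D x * ln (D x))"
    "(\<integral>x. D x * ln (D x) \<partial>P) = KL_divergence (exp 1) P Q"
    using RN[of "\<lambda>x. ln (D x)"] entropy_integrable by (simp_all add: ed KL_divergence_def)
qed

text \<open>Integrability of \<open>D\<close> * h under \<open>P\<close> is what is needed. Young's
  inequality at h and at -h dominates its absolute value by a \<open>P\<close>-integrable function,
  which is why both exponential moments are assumed.\<close>

lemma integrable_of_exp_moments:
  fixes h :: "'a \<Rightarrow> real"
  assumes h[measurable]: "h \<in> borel_measurable P"
    and pos: "integrable P (\<lambda>x. exp (h x))" and neg: "integrable P (\<lambda>x. exp (- h x))"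
  shows "integrable Q h"
proof -
  have "integrable P (\<lambda>x. D x * h x)"
  proof (rule Bochner_Integration.integrable_bound)
    show "integrable P (\<lambda>x. D x * ln (D x) - D x + exp (h x) + exp (- h x))"
      using pos neg density_integrals by auto
    \<comment> \<open>Each one-sided bound contains only one of the two exponentials; the other is
      positive and may be added.\<close>
    have "\<bar>D x * h x\<bar> \<le> D x * ln (D x) - D x + exp (h x) + exp (- h x)" for x
    proof -
      have "D x * h x \<le> D x * ln (D x) - D x + exp (h x)"
        "D x * - h x \<le> D x * ln (D x) - D x + exp (- h x)"
        by (intro young_ineq_exp enn2real_nonneg)+
      moreover have "0 < exp (h x)" "0 < exp (- h x)"
        by simp_all
      ultimately show ?thesis
        by linarith
    qed
    then show "AE x in P. norm (D x * h x) \<le> norm (D x * ln (D x) - D x + exp (h x) + exp (- h x))"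
      by (intro AE_I2) (smt (verit) real_norm_def)
  qed measurable
  then show ?thesis
    using RN(1)[OF h] by simp
qed

text \<open>The upper-bound half of the Donsker-Varadhan variational formula, with c in place of the
  log moment. Shifting h by c makes the exponential moment at most 1, which absorbs the -1 that the
  term -\<open>D\<close> contributes.\<close>

lemma donsker_varadhan_le:
  fixes h :: "'a \<Rightarrow> real"
  assumes h: "integrable Q h" and exp_h: "integrable P (\<lambda>x. exp (h x))"
    and bound: "(\<integral>x. exp (h x) \<partial>P) \<le> exp c"
  shows "(\<integral>x. h x \<partial>Q) \<le> KL_divergence (exp 1) P Q + c"
proof -
  have hP[measurable]: "h \<in> borel_measurable P"
    using borel_measurable_integrable[OF h] by (simp add: measurable_cong_sets[OF sets_eq refl])
  have Dh: "integrable P (\<lambda>x. D x * (h x - c))"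
    using RN(1)[of "\<lambda>x. h x - c"] h by simp
  have "(\<integral>x. h x \<partial>Q) - c = (\<integral>x. h x - c \<partial>Q)"
    using h by (simp add: Q.prob_space)
  also have "\<dots> = (\<integral>x. D x * (h x - c) \<partial>P)"
    by (intro RN(2)) simp
  also have "\<dots> \<le> (\<integral>x. D x * ln (D x) - D x + exp (h x - c) \<partial>P)"
    using Dh exp_h density_integrals
    by (intro integral_mono young_ineq_exp) (auto simp: exp_diff)
  also have "\<dots> = KL_divergence (exp 1) P Q - 1 + (\<integral>x. exp (h x) \<partial>P) / exp c"
    using exp_h density_integrals by (simp add: exp_diff)
  also have "\<dots> \<le> KL_divergence (exp 1) P Q"
    using bound by (simp add: divide_le_eq)
  finally show ?thesis
    by simp
qed

end

text \<open>A quadratic in t that is nonnegative everywhere has nonpositive discriminant, here m^2 -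
  2 v d. For v = 0 it degenerates to a linear function.\<close>

lemma abs_le_sqrt_of_quadratic_bound:
  fixes m d v :: real
  assumes v: "0 \<le> v" and bound: "\<And>t. t * m \<le> d + t\<^sup>2 * v / 2"
  shows "\<bar>m\<bar> \<le> sqrt (2 * v * d)"
proof (cases "v = 0")
  case True
  \<comment> \<open>A nonzero slope is impossible: t = (d + 1) / m would give d + 1 <= d.\<close>
  have "m = 0"
  proof (rule ccontr)
    assume "m \<noteq> 0"
    then show False
      using bound[of "(d + 1) / m"] True by simp
  qed
  then show ?thesis
    using True by simp
next
  case False
  have "m\<^sup>2 \<le> 2 * v * d"
    \<comment> \<open>The gap d + t^2 v / 2 - t m is smallest at t = m / v.\<close>
    using bound[of "m / v"] v False by (simp add: field_simps power2_eq_square)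
  then show ?thesis
    by (metis real_sqrt_abs real_sqrt_le_iff)
qed

text \<open>Independence factorises the moment generating function into n equal factors with
  parameter -t/n. The exponents add up to n (t/n)^2 v / 2, so averaging divides the variance proxy
  by n.\<close>

lemma subgaussian_sample_mean_mgf:
  fixes X :: "'z \<Rightarrow> real"
  assumes p: "prob_space p" and X: "prob_space.subgaussian p v X" and n: "1 \<le> n"
  shows "integrable (iid_sample p n)
           (\<lambda>z. exp (t * ((\<integral>x. X x \<partial>p) - (\<Sum>i=1..n. X (z i)) / real n)))" (is "integrable _ ?e")
    and "(\<integral>z. exp (t * ((\<integral>x. X x \<partial>p) - (\<Sum>i=1..n. X (z i)) / real n)) \<partial>iid_sample p n)
           \<le> exp (t\<^sup>2 * (v / real n) / 2)"
proof -
  interpret p: prob_space p by (rule p)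
  interpret product_sigma_finite "\<lambda>_::nat. p" by unfold_locales
  define m where "m = (\<integral>x. X x \<partial>p)"
  define s where "s = - t / real n"
  define f where "f x = exp (s * (X x - m))" for x
  have f: "integrable p f" and f_le: "integral\<^sup>L p f \<le> exp (s\<^sup>2 * v / 2)"
    using X unfolding p.subgaussian_def f_def m_def by auto
  have eq: "?e = (\<lambda>z. \<Prod>i\<in>{1..n}. f (z i))"
  proof
    fix z
    have "t * (m - (\<Sum>i=1..n. X (z i)) / real n) = (\<Sum>i=1..n. s * (X (z i) - m))"
      using n by (simp add: s_def sum_distrib_left[symmetric] sum_subtractf field_simps
          sum_negf sum_divide_distrib[symmetric])
    then show "?e z = (\<Prod>i\<in>{1..n}. f (z i))"
      by (simp add: f_def m_def exp_sum)
  qed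
  show "integrable (iid_sample p n) ?e"
    unfolding eq iid_sample_def by (intro product_integrable_prod f) simp
  have "integral\<^sup>L (iid_sample p n) ?e = (\<Prod>i\<in>{1..n}. integral\<^sup>L p f)"
    unfolding eq iid_sample_def by (intro product_integral_prod f) simp
  also have "\<dots> \<le> exp (s\<^sup>2 * v / 2) ^ n"
    using f_le by (simp add: f_def power_mono)
  also have "\<dots> = exp (t\<^sup>2 * (v / real n) / 2)"
    using n by (simp add: exp_of_nat_mult[symmetric] s_def power2_eq_square field_simps)
  finally show "integral\<^sup>L (iid_sample p n) ?e \<le> exp (t\<^sup>2 * (v / real n) / 2)" .
qed

lemma prob_space_iid_sample: "prob_space p \<Longrightarrow> prob_space (iid_sample p n)"
  unfolding iid_sample_def by (rule prob_space_PiM)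

text \<open>Mutual information refers to the marginals of the joint law, so the sample marginal has
  to be identified with the i.i.d. law before its product structure can be used.\<close>

lemma
  assumes M: "prob_space M" and K: "K \<in> M \<rightarrow>\<^sub>M prob_algebra N"
  shows prob_space_channel_joint: "prob_space (channel_joint M N K)"
    and sets_channel_joint: "sets (channel_joint M N K) = sets (M \<Otimes>\<^sub>M N)"
    and distr_channel_joint_fst: "distr (channel_joint M N K) M fst = M"
proof -
  interpret prob_space M by (rule M)
  note K[measurable]
  have kernel: "(\<lambda>x. K x \<bind> (\<lambda>y. return (M \<Otimes>\<^sub>M N) (x, y))) \<in> M \<rightarrow>\<^sub>M prob_algebra (M \<Otimes>\<^sub>M N)"
    by measurable
  have M_in: "M \<in> space (prob_algebra M)"
    using M by (simp add: space_prob_algebra)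
  show "prob_space (channel_joint M N K)"
    unfolding channel_joint_def by (rule prob_space_bind'[OF M_in kernel])
  show "sets (channel_joint M N K) = sets (M \<Otimes>\<^sub>M N)"
    unfolding channel_joint_def by (rule sets_bind'[OF M_in kernel])
  have Kx: "prob_space (K x)" "sets (K x) = sets N" if "x \<in> space M" for x
    using measurable_space[OF K that] by (auto simp: space_prob_algebra)
  have "distr (channel_joint M N K) M fst
      = M \<bind> (\<lambda>x. distr (K x \<bind> (\<lambda>y. return (M \<Otimes>\<^sub>M N) (x, y))) M fst)"
    unfolding channel_joint_def
    by (intro distr_bind[OF measurable_prob_algebraD[OF kernel] not_empty]) simp
  also have "\<dots> = M \<bind> return M"
  proof (intro bind_cong refl)
    \<comment> \<open>For fixed x the inner measure is the image of \<open>K x\<close> under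
      \<open>Pair x\<close>; its first coordinate is constantly x, hence a Dirac measure.\<close>
    fix x assume x: "x \<in> space M"
    interpret Kx: prob_space "K x" by (rule Kx[OF x])
    have [measurable]: "Pair x \<in> K x \<rightarrow>\<^sub>M M \<Otimes>\<^sub>M N"
      using x Kx[OF x] by (simp cong: measurable_cong_sets)
    have "distr (K x \<bind> (\<lambda>y. return (M \<Otimes>\<^sub>M N) (x, y))) M fst
        = distr (distr (K x) (M \<Otimes>\<^sub>M N) (Pair x)) M fst"
      by (subst bind_return_distr') (auto simp: Kx.not_empty)
    also have "\<dots> = distr (K x) M (\<lambda>_. x)"
      by (subst distr_distr) (auto simp: comp_def)
    also have "\<dots> = return M x"
      using x by (simp add: Kx.distr_const)
    finally show "distr (K x \<bind> (\<lambda>y. return (M \<Otimes>\<^sub>M N) (x, y))) M fst = return M x" .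
  qed
  also have "\<dots> = M"
    by (rule bind_return')
  finally show "distr (channel_joint M N K) M fst = M" .
qed

theorem theorem0p6:
  fixes p :: "'z measure" and MW :: "'w measure"
    and loss :: "'z \<Rightarrow> 'w \<Rightarrow> real"
    and K :: "(nat \<Rightarrow> 'z) \<Rightarrow> 'w measure"
    and \<sigma> :: real and n :: nat
  assumes p: "prob_space p"
    and n: "n \<ge> 1"
    and loss_measurable: "(\<lambda>(z, w). loss z w) \<in> borel_measurable (p \<Otimes>\<^sub>M MW)"
    and loss_nonneg: "\<And>z w. z \<in> space p \<Longrightarrow> w \<in> space MW \<Longrightarrow> 0 \<le> loss z w"
    and loss_subgaussian:
      "\<And>w. w \<in> space MW \<Longrightarrow> prob_space.subgaussian p (\<sigma>\<^sup>2) (\<lambda>z. loss z w)"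
    and algorithm: "K \<in> iid_sample p n \<rightarrow>\<^sub>M prob_algebra MW"
    and determinate: "\<sigma> \<noteq> 0 \<or> learning_information p n MW K \<noteq> \<infinity>"
      \<comment> \<open>otherwise the bound is the indeterminate form \<open>0 \<cdot> \<infinity>\<close>\<close>
  shows "(learning_information p n MW K \<noteq> \<infinity> \<longrightarrow>
            integrable (channel_joint (iid_sample p n) MW K)
              (\<lambda>(z, w). population_risk p loss w - empirical_risk loss n z w)) \<and>
         ereal \<bar>\<integral>(z, w). (population_risk p loss w - empirical_risk loss n z w)
                  \<partial>channel_joint (iid_sample p n) MW K\<bar>
           \<le> ereal_sqrt (ereal (2 * \<sigma>\<^sup>2 / real n) * learning_information p n MW K)"
proof (cases "learning_information p n MW K = \<infinity>")
  case True
  \<comment> \<open>By \<open>determinate\<close>, \<sigma> is nonzero here, so the factor in front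
    of the infinite information is positive.\<close>
  then have "ereal (2 * \<sigma>\<^sup>2 / real n) * learning_information p n MW K = \<infinity>"
    using determinate n by simp
  with True show ?thesis
    by (simp add: ereal_sqrt_def)
next
  case False
  let ?S = "iid_sample p n"
  define J where "J = channel_joint ?S MW K"
  define P where "P = distr J MW snd \<Otimes>\<^sub>M distr J ?S fst"
  define Q where "Q = distr J (MW \<Otimes>\<^sub>M ?S) (\<lambda>x. (snd x, fst x))"
  define v where "v = \<sigma>\<^sup>2 / real n"
  \<comment> \<open>The arguments come in the order (w, z) of \<open>P\<close> and \<open>Q\<close>,
    the reverse of \<open>J\<close>.\<close>
  define g where "g = (\<lambda>(w, z). population_risk p loss w - empirical_risk loss n z w)"
  interpret p: prob_space p by (rule p)
  interpret S: prob_space ?S by (rule prob_space_iid_sample[OF p])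
  interpret J: prob_space J
    unfolding J_def by (rule prob_space_channel_joint[OF S.prob_space_axioms algorithm])
  have sets_J[measurable_cong]: "sets J = sets (?S \<Otimes>\<^sub>M MW)"
    unfolding J_def by (rule sets_channel_joint[OF S.prob_space_axioms algorithm])
  have P_eq: "P = distr J MW snd \<Otimes>\<^sub>M ?S"
    unfolding P_def J_def distr_channel_joint_fst[OF S.prob_space_axioms algorithm] ..
  interpret W: prob_space "distr J MW snd"
    by (rule J.prob_space_distr) simp
  interpret WS: pair_prob_space "distr J MW snd" ?S
    by unfold_locales
  have P: "prob_space P"
    unfolding P_eq by (rule WS.prob_space_axioms)
  have Q: "prob_space Q"
    unfolding Q_def by (rule J.prob_space_distr) simp
  have sets_P[measurable_cong]: "sets P = sets (MW \<Otimes>\<^sub>M ?S)"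
    unfolding P_eq by (intro sets_pair_measure_cong) simp_all
  have sets_eq: "sets Q = sets P"
    by (simp add: Q_def sets_P)
  have info: "learning_information p n MW K =
      (if absolutely_continuous P Q \<and> integrable Q (entropy_density (exp 1) P Q)
       then ereal (KL_divergence (exp 1) P Q) else \<infinity>)"
    unfolding learning_information_def J_def[symmetric] J.ext_mutual_information_def
      J.mutual_information_def Let_def P_def[symmetric] Q_def[symmetric] ..
  with False have ac: "absolutely_continuous P Q"
    and ent: "integrable Q (entropy_density (exp 1) P Q)"
    and info_eq: "learning_information p n MW K = ereal (KL_divergence (exp 1) P Q)"
    by (auto split: if_splits)
  note kl = P Q ac sets_eq ent

  note loss_measurable[measurable]
  have [measurable]: "(\<lambda>z. z i) \<in> ?S \<rightarrow>\<^sub>M p" if "i \<in> {1..n}" for i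
    using that unfolding iid_sample_def by measurable
  have [measurable]: "(\<lambda>x. loss (snd x i) (fst x)) \<in> borel_measurable (MW \<Otimes>\<^sub>M ?S)"
    if i: "i \<in> {1..n}" for i
  proof -
    have "(\<lambda>x. (\<lambda>(z, w). loss z w) (snd x i, fst x)) \<in> borel_measurable (MW \<Otimes>\<^sub>M ?S)"
      using i by measurable
    then show ?thesis
      by simp
  qed
  have [measurable]: "population_risk p loss \<in> borel_measurable MW"
    unfolding population_risk_def by measurable
  have g[measurable]: "g \<in> borel_measurable (MW \<Otimes>\<^sub>M ?S)"
    unfolding g_def empirical_risk_def split_beta by measurable
  then have gP: "g \<in> borel_measurable P"
    by measurable

  \<comment> \<open>Nonnegative integrals allow Tonelli before integrability is known. The inner
    bound is uniform in w, so averaging over the law of W preserves it and also yields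
    integrability.\<close>
  have mgf: "integrable P (\<lambda>x. exp (t * g x))"
    "(\<integral>x. exp (t * g x) \<partial>P) \<le> exp (t\<^sup>2 * v / 2)" for t
  proof -
    have "(\<integral>\<^sup>+x. ennreal (exp (t * g x)) \<partial>P)
        = (\<integral>\<^sup>+w. \<integral>\<^sup>+z. ennreal (exp (t * g (w, z))) \<partial>?S \<partial>distr J MW snd)"
      unfolding P_eq by (rule S.nn_integral_fst[symmetric]) measurable
    also have "\<dots> \<le> (\<integral>\<^sup>+w. ennreal (exp (t\<^sup>2 * v / 2)) \<partial>distr J MW snd)"
    proof (rule nn_integral_mono)
      fix w assume "w \<in> space (distr J MW snd)"
      then have sub: "p.subgaussian (\<sigma>\<^sup>2) (\<lambda>z. loss z w)"
        by (simp add: loss_subgaussian)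
      note mgf = subgaussian_sample_mean_mgf[OF p sub n, of t]
      show "(\<integral>\<^sup>+z. ennreal (exp (t * g (w, z))) \<partial>?S) \<le> ennreal (exp (t\<^sup>2 * v / 2))"
        using mgf unfolding g_def v_def population_risk_def empirical_risk_def
        by (simp add: nn_integral_eq_integral)
    qed
    also have "\<dots> = ennreal (exp (t\<^sup>2 * v / 2))"
      by (simp add: W.emeasure_space_1[simplified])
    finally have le: "(\<integral>\<^sup>+x. ennreal (exp (t * g x)) \<partial>P) \<le> ennreal (exp (t\<^sup>2 * v / 2))" .
    show int: "integrable P (\<lambda>x. exp (t * g x))"
      using le gP by (intro integrableI_nonneg) (auto intro: le_less_trans)
    show "(\<integral>x. exp (t * g x) \<partial>P) \<le> exp (t\<^sup>2 * v / 2)"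
      using le by (simp add: nn_integral_eq_integral[OF int])
  qed

  \<comment> \<open>The moments at t = 1 and t = -1 are the two that the domination argument
    requires.\<close>
  have gQ: "integrable Q g"
    using mgf(1)[of 1] mgf(1)[of "-1"] by (intro integrable_of_exp_moments[OF kl gP]) simp_all
  have "t * (\<integral>x. g x \<partial>Q) \<le> KL_divergence (exp 1) P Q + t\<^sup>2 * v / 2" for t
    using donsker_varadhan_le[OF kl _ mgf, of t] gQ by simp
  then have bound: "\<bar>\<integral>x. g x \<partial>Q\<bar> \<le> sqrt (2 * v * KL_divergence (exp 1) P Q)"
    by (intro abs_le_sqrt_of_quadratic_bound) (simp_all add: v_def)

  \<comment> \<open>\<open>Q\<close> is the image of \<open>J\<close> under the coordinate swap, so
    integrability and the bound pull back to \<open>J\<close>.\<close>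
  have swap: "(\<lambda>x. (snd x, fst x)) \<in> J \<rightarrow>\<^sub>M MW \<Otimes>\<^sub>M ?S"
    by measurable
  have g_swap: "(\<lambda>x. g (snd x, fst x)) =
      (\<lambda>(z, w). population_risk p loss w - empirical_risk loss n z w)"
    by (auto simp: g_def)
  show ?thesis
    using gQ bound
    unfolding Q_def integrable_distr_eq[OF swap g] integral_distr[OF swap g] g_swap
    unfolding Q_def[symmetric] J_def[symmetric] info_eq
    by (simp add: ereal_sqrt_def v_def)
qed

end
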